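(* Let $\mathcal{P}=\{A_1,A_2,A_3,A_4,A_5\}$. Then for every integer $n\ge 2$, $$s_n(\mathcal{P}\cup\{B_1\})=s_n(\mathcal{P}\cup\{B_5\})=s_n(\mathcal{P}\cup\{B_6\})=\sum_{i=1}^{2n-2}\binom{i+3}{3}E(2n-2,i)+S(n+1),$$ $$s_n(\mathcal{P}\cup\{B_2\})=s_n(\mathcal{P}\cup\{B_4\})=\sum_{i=1}^{2n-2}(2n-1-i)\binom{i+2}{2}E(2n-2,i)+S(n+1),$$ $$s_n(\mathcal{P}\cup\{B_3\})=\sum_{i=1}^{2n-2}(i+1)\binom{2n-i}{2}E(2n-2,i)+S(n+1).$$
   Context: A standard piece is a $2\times 2$ matrix whose four entries are $1,2,3,4$, each occurring exactly once. For $n\ge 1$, a standard $n$-puzzle is a $2\times(n+1)$ matrix whose entries are $1,2,\dots,2n+2$, each occurring exactly once; its pieces are its $n$ submatrices formed by two consecutive columns. The reduction of a piece is the standard piece obtained by replacing its four distinct entries by $1,2,3,4$ in an order-preserving way. A set $\mathcal{P}$ of standard pieces is a support of a puzzle if the reduction of each piece of the puzzle lies in $\mathcal{P}$. $S_n(\mathcal{P})$ is the set of standard $n$-puzzles having $\mathcal{P}$ as a support, and $s_n(\mathcal{P})=|S_n(\mathcal{P})|$. The standard pieces used are $A_1=\left[\begin{smallmatrix}4&3\\1&2\end{smallmatrix}\right]$, $A_2=\left[\begin{smallmatrix}3&4\\1&2\end{smallmatrix}\right]$, $A_3=\left[\begin{smallmatrix}2&4\\1&3\end{smallmatrix}\right]$,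 $A_4=\left[\begin{smallmatrix}3&4\\2&1\end{smallmatrix}\right]$, $A_5=\left[\begin{smallmatrix}4&3\\2&1\end{smallmatrix}\right]$, and $B_1=\left[\begin{smallmatrix}4&2\\1&3\end{smallmatrix}\right]$, $B_2=\left[\begin{smallmatrix}3&2\\1&4\end{smallmatrix}\right]$, $B_3=\left[\begin{smallmatrix}2&3\\1&4\end{smallmatrix}\right]$, $B_4=\left[\begin{smallmatrix}3&1\\2&4\end{smallmatrix}\right]$, $B_5=\left[\begin{smallmatrix}4&1\\2&3\end{smallmatrix}\right]$, $B_6=\left[\begin{smallmatrix}4&1\\3&2\end{smallmatrix}\right]$. $E(n,k)$ (Entringer number, OEIS A008282) is the number of down-up permutations $\pi_1>\pi_2<\pi_3>\cdots$ of $\{1,\dots,n+1\}$ with $\pi_1=k+1$. $S(m)$ is the $m$-th secant number, defined by $\sec x=\sum_{m\ge0}S(m)\frac{x^{2m}}{(2m)!}$ (OEIS A000364). *)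

theory Defs
  imports
    "Jordan_Normal_Form.Matrix"
    "HOL-Computational_Algebra.Formal_Power_Series"
    "HOL-Combinatorics.Permutations"
begin

text \<open>Matrices use the 0-based indices of \<^theory>\<open>Jordan_Normal_Form.Matrix\<close>; row 0 is the top row.\<close>

definition standard_piece :: "nat mat \<Rightarrow> bool" where
  "standard_piece Q \<longleftrightarrow>
     Q \<in> carrier_mat 2 2 \<and> bij_betw (\<lambda>ij. Q $$ ij) ({0..<2} \<times> {0..<2}) {1..4}"

definition standard_puzzle :: "nat \<Rightarrow> nat mat \<Rightarrow> bool" where
  "standard_puzzle n M \<longleftrightarrow>
     M \<in> carrier_mat 2 (n + 1) \<and>
     bij_betw (\<lambda>ij. M $$ ij) ({0..<2} \<times> {0..<n + 1}) {1..2 * n + 2}"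

definition piece :: "nat mat \<Rightarrow> nat \<Rightarrow> nat mat" where
  "piece M k = mat 2 2 (\<lambda>(i, j). M $$ (i, k + j))"

definition pieces :: "nat mat \<Rightarrow> nat mat set" where
  "pieces M = {piece M k |k. k + 1 < dim_col M}"

text \<open>The order-preserving replacement of the entries by \<open>1, 2, \<dots>\<close> sends an entry to its rank
  among the entries.\<close>

definition reduction :: "nat mat \<Rightarrow> nat mat" where
  "reduction Q = map_mat (\<lambda>x. card {y \<in> elements_mat Q. y \<le> x}) Q"

definition is_support :: "nat mat set \<Rightarrow> nat mat \<Rightarrow> bool" where
  "is_support P M \<longleftrightarrow> (\<forall>Q \<in> pieces M. reduction Q \<in> P)"

definition puzzles :: "nat \<Rightarrow> nat mat set \<Rightarrow> nat mat set" where
  "puzzles n P = {M. standard_puzzle n M \<and> is_support P M}"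

definition num_puzzles :: "nat \<Rightarrow> nat mat set \<Rightarrow> nat" where
  "num_puzzles n P = card (puzzles n P)"

definition A\<^sub>1 :: "nat mat" where "A\<^sub>1 = mat_of_rows_list 2 [[4, 3], [1, 2]]"
definition A\<^sub>2 :: "nat mat" where "A\<^sub>2 = mat_of_rows_list 2 [[3, 4], [1, 2]]"
definition A\<^sub>3 :: "nat mat" where "A\<^sub>3 = mat_of_rows_list 2 [[2, 4], [1, 3]]"
definition A\<^sub>4 :: "nat mat" where "A\<^sub>4 = mat_of_rows_list 2 [[3, 4], [2, 1]]"
definition A\<^sub>5 :: "nat mat" where "A\<^sub>5 = mat_of_rows_list 2 [[4, 3], [2, 1]]"

definition B\<^sub>1 :: "nat mat" where "B\<^sub>1 = mat_of_rows_list 2 [[4, 2], [1, 3]]"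
definition B\<^sub>2 :: "nat mat" where "B\<^sub>2 = mat_of_rows_list 2 [[3, 2], [1, 4]]"
definition B\<^sub>3 :: "nat mat" where "B\<^sub>3 = mat_of_rows_list 2 [[2, 3], [1, 4]]"
definition B\<^sub>4 :: "nat mat" where "B\<^sub>4 = mat_of_rows_list 2 [[3, 1], [2, 4]]"
definition B\<^sub>5 :: "nat mat" where "B\<^sub>5 = mat_of_rows_list 2 [[4, 1], [2, 3]]"
definition B\<^sub>6 :: "nat mat" where "B\<^sub>6 = mat_of_rows_list 2 [[4, 1], [3, 2]]"

definition down_up :: "nat \<Rightarrow> (nat \<Rightarrow> nat) \<Rightarrow> bool" where
  "down_up N \<pi> \<longleftrightarrow>
     (\<forall>i \<in> {1..<N}. if odd i then \<pi> i > \<pi> (i + 1) else \<pi> i < \<pi> (i + 1))"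

definition entringer :: "nat \<Rightarrow> nat \<Rightarrow> nat" where
  "entringer n k = card {\<pi>. \<pi> permutes {1..n + 1} \<and> down_up (n + 1) \<pi> \<and> \<pi> 1 = k + 1}"

text \<open>The secant series is taken as the formal power series inverse of the cosine series.\<close>

definition secant_number :: "nat \<Rightarrow> real" where
  "secant_number m = fact (2 * m) * fps_nth (inverse (fps_cos 1)) (2 * m)"

lemma finite_puzzles: "finite (puzzles n P)"
proof -
  let ?I = "{0..<2::nat} \<times> {0..<n + 1}"
  have "puzzles n P \<subseteq> mat 2 (n + 1) ` (?I \<rightarrow>\<^sub>E {1..2 * n + 2})"
  proof
    fix M assume "M \<in> puzzles n P"
    hence M: "M \<in> carrier_mat 2 (n + 1)" and b: "bij_betw (\<lambda>ij. M $$ ij) ?I {1..2 * n + 2}"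
      by (auto simp: puzzles_def standard_puzzle_def)
    have "M = mat 2 (n + 1) (restrict (\<lambda>ij. M $$ ij) ?I)"
      using M by (intro eq_matI) auto
    moreover have "restrict (\<lambda>ij. M $$ ij) ?I \<in> ?I \<rightarrow>\<^sub>E {1..2 * n + 2}"
      using bij_betw_imp_funcset[OF b] by auto
    ultimately show "M \<in> mat 2 (n + 1) ` (?I \<rightarrow>\<^sub>E {1..2 * n + 2})" by blast
  qed
  moreover have "finite (?I \<rightarrow>\<^sub>E {1..2 * n + 2})" by (intro finite_PiE) auto
  ultimately show ?thesis using finite_subset by blast
qed

lemma standard_pieces:
  assumes "Q \<in> {A\<^sub>1, A\<^sub>2, A\<^sub>3, A\<^sub>4, A\<^sub>5, B\<^sub>1, B\<^sub>2, B\<^sub>3, B\<^sub>4, B\<^sub>5, B\<^sub>6}"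
  shows "standard_piece Q"
proof -
  have I: "{0..<2::nat} \<times> {0..<2::nat} = {(0, 0), (0, 1), (1, 0), (1, 1)}" by auto
  have J: "{1..4::nat} = {1, 2, 3, 4}" by auto
  show ?thesis
    using assms
    by (auto simp: standard_piece_def bij_betw_def I J mat_of_rows_list_def inj_on_def
      A\<^sub>1_def A\<^sub>2_def A\<^sub>3_def A\<^sub>4_def A\<^sub>5_def
      B\<^sub>1_def B\<^sub>2_def B\<^sub>3_def B\<^sub>4_def B\<^sub>5_def B\<^sub>6_def)
qed

end

theory Submission
  imports Defs "HOL-Combinatorics.Multiset_Permutations"
begin

text \<open>A piece reduces to one of the \<open>A\<^sub>i\<close> iff both columns descend and its lower left entry is below
  its upper right entry. Hence, read column by column, the puzzles supported by the \<open>A\<^sub>i\<close> are the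
  down-up permutations of \<open>{1..2n+2}\<close>, which the secant number counts. The remaining puzzles have
  \<open>B\<^sub>j\<close> as their last piece. In reverse order such a puzzle consists of three entries \<open>y, x, b\<close>
  followed by a down-up list of length \<open>2n-1\<close> with first entry \<open>v\<close>, and \<open>B\<^sub>j\<close> prescribes the
  relative order of \<open>y, x, b, v\<close>. If \<open>a\<close> of the three entries have to lie below \<open>v\<close> and \<open>v\<close> is
  the \<open>(i+1)\<close>-th smallest entry of the down-up list, then \<open>v = i + a + 1\<close>, so there are
  \<open>binom(i+a, a) * binom(2n+1-a-i, 3-a)\<close> choices for the three entries and \<open>E(2n-2, i)\<close> choices
  for the list.\<close>

section \<open>Down-up lists, relabelling, and Entringer numbers\<close>

text \<open>List indices start at 0, so descents sit at even positions; \<open>down_up\<close>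
  counts from 1 and has them at odd ones.\<close>

definition down_up_list :: "nat list \<Rightarrow> bool" where
  "down_up_list xs \<longleftrightarrow>
     (\<forall>i. Suc i < length xs \<longrightarrow> (if even i then xs ! Suc i < xs ! i else xs ! i < xs ! Suc i))"

definition down_ups :: "nat set \<Rightarrow> nat list set" where
  "down_ups A = {xs \<in> permutations_of_set A. down_up_list xs}"

lemma finite_down_ups: "finite (down_ups A)"
  unfolding down_ups_def by (rule finite_subset[OF _ finite_permutations_of_set]) auto

lemma down_ups_length: "xs \<in> down_ups A \<Longrightarrow> length xs = card A"
  by (simp add: down_ups_def length_finite_permutations_of_set)

lemma down_up_list_map:
  assumes "strict_mono_on A f" "set xs \<subseteq> A"
  shows "down_up_list (map f xs) \<longleftrightarrow> down_up_list xs"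
proof -
  have "f (xs ! i) < f (xs ! j) \<longleftrightarrow> xs ! i < xs ! j" if "i < length xs" "j < length xs" for i j
    using assms that by (intro strict_mono_on_less[OF assms(1)]) auto
  then show ?thesis unfolding down_up_list_def by (auto simp: Suc_lessD)
qed

text \<open>The down-up condition depends only on comparisons between entries, and a strictly
  increasing relabelling preserves these.\<close>

lemma bij_betw_map_down_ups:
  assumes "strict_mono_on A f"
  shows "bij_betw (map f) (down_ups A) (down_ups (f ` A))"
proof -
  have inj: "inj_on f A"
    using assms by (rule strict_mono_on_imp_inj_on)
  have im: "map f ` permutations_of_set A = permutations_of_set (f ` A)"
    using permutations_of_set_image_inj[OF inj] by simp
  have "inj_on (map f) (permutations_of_set A)"
    by (rule inj_onI, erule map_inj_on) (simp add: permutations_of_set_def inj)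
  then have "inj_on (map f) (down_ups A)"
    by (rule inj_on_subset) (auto simp: down_ups_def)
  moreover have "map f ` down_ups A = down_ups (f ` A)"
  proof -
    have "down_up_list (map f xs) \<longleftrightarrow> down_up_list xs" if "xs \<in> permutations_of_set A" for xs
      using that by (intro down_up_list_map[OF assms]) (auto simp: permutations_of_set_def)
    then show ?thesis
      unfolding down_ups_def im[symmetric] by auto
  qed
  ultimately show ?thesis unfolding bij_betw_def ..
qed

text \<open>The elements below the smaller of two members of \<open>A\<close> form a proper subset
  of those below the larger one, since the smaller member belongs only to the latter. The
  \<open>Suc\<close> makes ranks start at 1.\<close>

lemma strict_mono_on_rank:
  fixes A :: "nat set"
  assumes "finite A"
  shows "strict_mono_on A (\<lambda>x. Suc (card {y \<in> A. y < x}))"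
  by (intro strict_mono_onI) (use assms in \<open>auto intro!: psubset_card_mono\<close>)

text \<open>All ranks lie in the interval, and by injectivity there are as many of them as elements
  of \<open>A\<close>.\<close>

lemma image_rank:
  fixes A :: "nat set"
  assumes "finite A"
  shows "(\<lambda>x. Suc (card {y \<in> A. y < x})) ` A = {1..card A}"
proof (rule card_subset_eq)
  have "card {y \<in> A. y < x} < card A" if "x \<in> A" for x
    using assms that by (intro psubset_card_mono) auto
  then show "(\<lambda>x. Suc (card {y \<in> A. y < x})) ` A \<subseteq> {1..card A}" 
    by (auto simp: Suc_le_eq)
  show "card ((\<lambda>x. Suc (card {y \<in> A. y < x})) ` A) = card {1..card A}"
    using card_image[OF strict_mono_on_imp_inj_on[OF strict_mono_on_rank[OF assms]]] by simp
qed simp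

lemma card_down_ups:
  assumes "finite A"
  shows "card (down_ups A) = card (down_ups {1..card A})"
  using bij_betw_same_card[OF bij_betw_map_down_ups[OF strict_mono_on_rank[OF assms]]]
  by (simp only: image_rank[OF assms])

text \<open>Relabelling by rank sends a first entry \<open>v\<close> to its rank; injectivity of the
  rank on \<open>A\<close> gives the converse.\<close>

lemma card_down_ups_hd:
  assumes "finite A" "v \<in> A"
  shows "card {xs \<in> down_ups A. hd xs = v} =
    card {xs \<in> down_ups {1..card A}. hd xs = Suc (card {y \<in> A. y < v})}"
proof -
  define f where "f = (\<lambda>x. Suc (card {y \<in> A. y < x}))"
  have mono: "strict_mono_on A f"
    unfolding f_def by (rule strict_mono_on_rank[OF assms(1)])
  have im: "f ` A = {1..card A}"
    unfolding f_def by (rule image_rank[OF assms(1)])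
  have "f (hd xs) = f v \<longleftrightarrow> hd xs = v" if "xs \<in> down_ups A" for xs
    using that assms inj_onD[OF strict_mono_on_imp_inj_on[OF mono], of "hd xs" v]
    by (cases xs) (auto simp: down_ups_def permutations_of_set_def)
  moreover have "hd (map f xs) = f (hd xs)" if "xs \<in> down_ups A" for xs
    using that assms by (cases xs) (auto simp: down_ups_def permutations_of_set_def)
  ultimately have "{xs \<in> down_ups {1..card A}. hd xs = f v} = map f ` {xs \<in> down_ups A. hd xs = v}"
    using bij_betw_imp_surj_on[OF bij_betw_map_down_ups[OF mono], unfolded im, symmetric] by auto
  then have "bij_betw (map f) {xs \<in> down_ups A. hd xs = v}
      {xs \<in> down_ups {1..card A}. hd xs = f v}"
    by (intro bij_betw_subset[OF bij_betw_map_down_ups[OF mono]]) auto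
  from bij_betw_same_card[OF this] show ?thesis by (simp add: f_def)
qed

text \<open>The bijection \<open>?F\<close> is one-line notation. Passing from positions counted
  from 1 to positions counted from 0 swaps the parities in the two down-up conditions.\<close>

lemma entringer_eq_card_down_ups:
  "entringer n k = card {xs \<in> down_ups {1..n + 1}. hd xs = k + 1}"
proof -
  let ?N = "n + 1"
  let ?F = "\<lambda>\<pi>::nat \<Rightarrow> nat. map \<pi> [1..<?N + 1]"
  let ?X = "{\<pi>. \<pi> permutes {1..?N} \<and> down_up ?N \<pi> \<and> \<pi> 1 = k + 1}"
  let ?Y = "{xs \<in> down_ups {1..?N}. hd xs = k + 1}"
  have du: "down_up_list (?F \<pi>) \<longleftrightarrow> down_up ?N \<pi>" for \<pi>
  proof -
    have nth: "?F \<pi> ! i = \<pi> (Suc i)" if "i < ?N" for i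
      using that by (simp del: upt_Suc)
    have len: "length (?F \<pi>) = ?N" by (simp del: upt_Suc)
    have "{1..<?N} = Suc ` {..<n}" by (simp add: lessThan_atLeast0)
    then have "down_up ?N \<pi> \<longleftrightarrow>
      (\<forall>i<n. if odd (Suc i) then \<pi> (Suc i) > \<pi> (Suc i + 1) else \<pi> (Suc i) < \<pi> (Suc i + 1))"
      unfolding down_up_def by auto
    also have "\<dots> \<longleftrightarrow> down_up_list (?F \<pi>)"
    proof -
      have "(i < n \<longrightarrow> (if odd (Suc i) then \<pi> (Suc i) > \<pi> (Suc i + 1) else \<pi> (Suc i) < \<pi> (Suc i + 1)))
        \<longleftrightarrow> (Suc i < ?N \<longrightarrow> (if even i then ?F \<pi> ! Suc i < ?F \<pi> ! i else ?F \<pi> ! i < ?F \<pi> ! Suc i))" for i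
      proof (cases "i < n")
        case True
        then show ?thesis
          using nth[of i] nth[of "Suc i"] by (simp del: upt_Suc upt.simps)
      qed simp
      then show ?thesis unfolding down_up_list_def len by blast
    qed
    finally show ?thesis ..
  qed
  have hd: "hd (?F \<pi>) = \<pi> 1" for \<pi>
    by (simp add: upt_conv_Cons del: upt_Suc)
  have "inj_on ?F ?X"
  proof (rule inj_onI)
    fix \<pi> \<rho> assume *: "\<pi> \<in> ?X" "\<rho> \<in> ?X" "?F \<pi> = ?F \<rho>"
    show "\<pi> = \<rho>"
    proof
      fix i
      \<comment> \<open>Inside the interval the two lists agree; outside it both permutations are
        the identity.\<close>
      show "\<pi> i = \<rho> i"
        using * by (cases "i \<in> {1..?N}") (auto simp: permutes_def simp del: upt_Suc)
    qed
  qed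
  moreover have "?F ` ?X = ?Y"
  proof (intro equalityI subsetI)
    fix xs assume "xs \<in> ?F ` ?X"
    then obtain \<pi> where \<pi>: "\<pi> \<in> ?X" "xs = ?F \<pi>" by blast
    have perm: "\<pi> permutes {1..?N}" using \<pi> by simp
    have "set [1..<?N + 1] = {1..?N}" by auto
    then have "?F \<pi> \<in> permutations_of_set {1..?N}"
      using permutes_image[OF perm] permutes_inj_on[OF perm]
      by (simp add: permutations_of_set_def distinct_map del: upt_Suc)
    then show "xs \<in> ?Y"
      using \<pi> du hd by (auto simp: down_ups_def simp del: upt_Suc)
  next
    fix xs assume xs: "xs \<in> ?Y"
    then have len: "length xs = ?N" and d: "distinct xs" and s: "set xs = {1..?N}"
      using down_ups_length[of xs "{1..?N}"] by (auto simp: down_ups_def permutations_of_set_def)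
    define \<pi> where "\<pi> i = (if i \<in> {1..?N} then xs ! (i - 1) else i)" for i
    have F: "?F \<pi> = xs"
      by (rule nth_equalityI) (auto simp: len \<pi>_def simp del: upt_Suc)
    have "bij_betw \<pi> {1..?N} {1..?N}"
    proof -
      have "set [1..<?N + 1] = {1..?N}" by auto
      then show ?thesis
        unfolding bij_betw_def using F d s distinct_map[of \<pi> "[1..<?N+1]"] set_map[of \<pi> "[1..<?N+1]"]
        by metis
    qed
    then have "\<pi> permutes {1..?N}"
      by (rule bij_imp_permutes) (auto simp: \<pi>_def)
    then show "xs \<in> ?F ` ?X"
      using xs du[of \<pi>] hd[of \<pi>] F by (intro image_eqI[of _ _ \<pi>]) (auto simp: down_ups_def simp del: upt_Suc)
  qed
  ultimately have "bij_betw ?F ?X ?Y" unfolding bij_betw_def ..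
  then show ?thesis
    unfolding entringer_def by (rule bij_betw_same_card)
qed

text \<open>After relabelling, the second argument of \<open>entringer\<close> is the number of
  values below the first entry, and the first argument is one less than the length.\<close>

lemma card_down_ups_hd_entringer:
  assumes "finite A" "v \<in> A"
  shows "card {xs \<in> down_ups A. hd xs = v} = entringer (card A - 1) (card {y \<in> A. y < v})"
proof -
  have "card A > 0" using assms card_gt_0_iff by blast
  then show ?thesis
    unfolding entringer_eq_card_down_ups using card_down_ups_hd[OF assms] by simp
qed

text \<open>A smallest first entry cannot be followed by a descent, and there is a second entry
  since \<open>n > 0\<close>. This removes a boundary term when the sum over the first entry is
  shifted.\<close>

lemma entringer_0_right:
  assumes "n > 0"
  shows "entringer n 0 = 0"
proof -
  have False if "xs \<in> down_ups {1..n + 1}" "hd xs = 1" for xs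
  proof -
    have len: "length xs = n + 1" using down_ups_length[OF that(1)] by simp
    then have "xs ! 1 < xs ! 0" using that assms by (auto simp: down_ups_def down_up_list_def)
    moreover have "xs ! 1 \<in> set xs" using len assms by (intro nth_mem) auto
    moreover have "xs ! 0 = 1" using that len by (simp add: hd_conv_nth flip: length_0_conv)
    ultimately show False
      using that by (auto simp: down_ups_def permutations_of_set_def)
  qed
  then have "{xs \<in> down_ups {1..n + 1}. hd xs = 0 + 1} = {}" by auto
  then show ?thesis unfolding entringer_eq_card_down_ups by (simp only: card.empty)
qed

subsection \<open>Secant numbers\<close>

text \<open>These lists are what a term of the convolution of secant and cosine counts: the
  decreasing tail has a single arrangement and so plays the part of a cosine coefficient, up to
  sign.\<close>

definition down_up_then_decreasing :: "nat \<Rightarrow> nat set \<Rightarrow> nat list set" where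
  "down_up_then_decreasing k A =
     {xs \<in> permutations_of_set A. down_up_list (take k xs) \<and> sorted_wrt (>) (drop k xs)}"

text \<open>Choose the set \<open>B\<close> of the first \<open>k\<close> values and a down-up
  arrangement of it; the rest must follow in decreasing order.\<close>

lemma card_down_up_then_decreasing:
  assumes "finite A" "k \<le> card A"
  shows "card (down_up_then_decreasing k A) = (card A choose k) * card (down_ups {1..k})"
proof -
  let ?S = "SIGMA B:{B. B \<subseteq> A \<and> card B = k}. down_ups B"
  let ?F = "\<lambda>(B, ys). ys @ rev (sorted_list_of_set (A - B))"
  have "inj_on ?F ?S"
  proof (rule inj_onI, clarify)
    fix B ys B' ys'
    assume B: "B \<subseteq> A" "k = card B" "ys \<in> down_ups B"
      and B': "B' \<subseteq> A" "card B' = card B" "ys' \<in> down_ups B'"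
      and eq: "ys @ rev (sorted_list_of_set (A - B)) = ys' @ rev (sorted_list_of_set (A - B'))"
    have "length ys = length ys'" using B B' by (simp add: down_ups_length)
    then have "ys = ys'" using eq by simp
    moreover have "set ys = B" "set ys' = B'"
      using B B' by (auto simp: down_ups_def permutations_of_set_def)
    ultimately show "B = B' \<and> ys = ys'" by simp
  qed
  moreover have "?F ` ?S = down_up_then_decreasing k A"
  proof (intro equalityI subsetI)
    fix xs assume "xs \<in> ?F ` ?S"
    then obtain B ys where B: "B \<subseteq> A" "card B = k" "ys \<in> down_ups B"
      "xs = ys @ rev (sorted_list_of_set (A - B))" by auto
    have "length ys = k" using B by (simp add: down_ups_length)
    then show "xs \<in> down_up_then_decreasing k A"
      using B assms strict_sorted_list_of_set[of "A - B"]
      by (auto simp: down_up_then_decreasing_def down_ups_def permutations_of_set_def sorted_wrt_rev)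
  next
    fix xs assume xs: "xs \<in> down_up_then_decreasing k A"
    let ?B = "set (take k xs)"
    have d: "distinct xs" and s: "set xs = A"
      using xs by (auto simp: down_up_then_decreasing_def permutations_of_set_def)
    have len: "length xs = card A" using d s distinct_card by fastforce
    have "set (take k xs) \<inter> set (drop k xs) = {}" by (rule set_take_disj_set_drop_if_distinct[OF d]) simp
    moreover have "set (take k xs) \<union> set (drop k xs) = A" using s by (metis append_take_drop_id set_append)
    ultimately have set: "set (drop k xs) = A - ?B" by blast
    \<comment> \<open>The tail is the only decreasing listing of the values outside
      \<open>?B\<close>, so the prefix determines the whole list.\<close>
    have "sorted_list_of_set (A - ?B) = rev (drop k xs)"
      using xs set by (intro strict_sorted_equal)
       (auto simp: down_up_then_decreasing_def sorted_wrt_rev assms strict_sorted_list_of_set)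
    then have "xs = ?F (?B, take k xs)" by simp
    moreover have "card ?B = k" using d len assms by (simp add: distinct_card)
    moreover have "?B \<subseteq> A" using s set_take_subset by fast
    moreover have "take k xs \<in> down_ups ?B"
      using xs d by (auto simp: down_up_then_decreasing_def down_ups_def permutations_of_set_def)
    ultimately show "xs \<in> ?F ` ?S"
      by (intro image_eqI[of _ _ "(?B, take k xs)"]) auto
  qed
  ultimately have "bij_betw ?F ?S (down_up_then_decreasing k A)" unfolding bij_betw_def ..
  then have "card (down_up_then_decreasing k A) = card ?S"
    by (rule bij_betw_same_card[symmetric])
  also have "\<dots> = (\<Sum>B\<in>{B. B \<subseteq> A \<and> card B = k}. card (down_ups B))"
    using assms by (intro card_SigmaI) (auto simp: finite_down_ups)
  also have "\<dots> = (\<Sum>B\<in>{B. B \<subseteq> A \<and> card B = k}. card (down_ups {1..k}))"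
  proof (rule sum.cong[OF refl])
    fix B assume "B \<in> {B. B \<subseteq> A \<and> card B = k}"
    then show "card (down_ups B) = card (down_ups {1..k})"
      using card_down_ups[of B] finite_subset[OF _ assms(1), of B] by simp
  qed
  finally show ?thesis
    using n_subsets[OF assms(1), of k] by simp
qed

lemma sum_alternating_telescope:
  fixes y :: "nat \<Rightarrow> 'a::comm_ring_1"
  shows "(\<Sum>j\<le>m. (-1) ^ j * (y j + y (Suc j))) = y 0 + (-1) ^ m * y (Suc m)"
  by (induction m) (simp_all add: algebra_simps)

text \<open>With distinct entries an ascent is the negation of a descent, so the pattern becomes a
  parity condition on the descent positions.\<close>

lemma down_up_list_iff_descents:
  assumes "distinct xs"
  shows "down_up_list (take k xs) \<longleftrightarrow>
    (\<forall>i. Suc i < length xs \<longrightarrow> Suc i < k \<longrightarrow> (xs ! Suc i < xs ! i \<longleftrightarrow> even i))"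
proof -
  have "xs ! i < xs ! Suc i \<longleftrightarrow> \<not> xs ! Suc i < xs ! i" if "Suc i < length xs" for i
    using nth_eq_iff_index_eq[OF assms, of i "Suc i"] that by (auto simp: not_less le_less)
  then show ?thesis
    unfolding down_up_list_def by (auto split: if_splits)
qed

text \<open>By transitivity it suffices to compare neighbours; this puts the tail condition in terms
  of descent positions as well.\<close>

lemma sorted_wrt_greater_drop_iff:
  fixes xs :: "nat list"
  shows "sorted_wrt (>) (drop k xs) \<longleftrightarrow>
    (\<forall>i. Suc i < length xs \<longrightarrow> k \<le> i \<longrightarrow> xs ! Suc i < xs ! i)"
proof -
  have "sorted_wrt (>) (drop k xs) \<longleftrightarrow>
      (\<forall>i. Suc i < length xs - k \<longrightarrow> xs ! (k + Suc i) < xs ! (k + i))"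
    by (subst sorted_wrt_iff_nth_Suc_transp) (auto simp: transp_def less_diff_conv)
  also have "\<dots> \<longleftrightarrow> (\<forall>i. Suc i < length xs \<longrightarrow> k \<le> i \<longrightarrow> xs ! Suc i < xs ! i)"
  proof (intro iffI allI impI)
    fix i assume *: "\<forall>i. Suc i < length xs - k \<longrightarrow> xs ! (k + Suc i) < xs ! (k + i)" "Suc i < length xs" "k \<le> i"
    then show "xs ! Suc i < xs ! i" by (auto dest: spec[of _ "i - k"])
  qed auto
  finally show ?thesis .
qed

text \<open>\<open>X j\<close> collects the permutations that are down-up on the first \<open>2j\<close> entries and decreasing
  afterwards. Depending on the comparison at the junction, such a permutation lies in \<open>Y j\<close>
  (descent) or in \<open>Y (j+1)\<close> (ascent), so the alternating sum telescopes.\<close>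

lemma sum_alternating_down_ups:
  assumes "m > 0"
  shows "(\<Sum>j\<le>m. (-1) ^ j * real ((2 * m choose (2 * j)) * card (down_ups {1..2 * j}))) = 0"
proof -
  let ?A = "{1..2 * m}"
  define X where "X j = down_up_then_decreasing (2 * j) ?A" for j
  \<comment> \<open>Dropping only \<open>2 * j - 1\<close> entries keeps the last entry of the
    prefix, so the descent at the junction is included. The bounds on \<open>j\<close> make
    \<open>Y 0\<close> and \<open>Y (Suc m)\<close> empty, which kills both ends of the telescoping
    sum.\<close>
  define Y where "Y j = {xs \<in> permutations_of_set ?A. 0 < j \<and> j \<le> m \<and>
    down_up_list (take (2 * j) xs) \<and> sorted_wrt (>) (drop (2 * j - 1) xs)}" for j
  have X: "card (X j) = card (Y j) + card (Y (Suc j))" if "j \<le> m" for j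
  proof -
    have mem: "(xs \<in> X j \<longleftrightarrow> xs \<in> Y j \<or> xs \<in> Y (Suc j)) \<and> \<not> (xs \<in> Y j \<and> xs \<in> Y (Suc j))" for xs
    proof (cases "xs \<in> permutations_of_set ?A")
      case False
      then show ?thesis by (simp add: X_def Y_def down_up_then_decreasing_def)
    next
      case True
      then have d: "distinct xs" and len: "length xs = 2 * m"
        using length_finite_permutations_of_set[OF True] by (auto simp: permutations_of_set_def)
      define D where "D i \<longleftrightarrow> xs ! Suc i < xs ! i" for i
      have x: "xs \<in> X j \<longleftrightarrow> (\<forall>i. Suc i < 2 * m \<longrightarrow> (Suc i < 2 * j \<longrightarrow> (D i \<longleftrightarrow> even i)) \<and> (2 * j \<le> i \<longrightarrow> D i))"
        unfolding X_def down_up_then_decreasing_def mem_Collect_eq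
          down_up_list_iff_descents[OF d] sorted_wrt_greater_drop_iff
        by (simp only: len True D_def) blast
      have y: "xs \<in> Y j \<longleftrightarrow> 0 < j \<and> j \<le> m \<and>
          (\<forall>i. Suc i < 2 * m \<longrightarrow> (Suc i < 2 * j \<longrightarrow> (D i \<longleftrightarrow> even i)) \<and> (2 * j - 1 \<le> i \<longrightarrow> D i))" for j
        unfolding Y_def mem_Collect_eq
          down_up_list_iff_descents[OF d] sorted_wrt_greater_drop_iff
        by (simp only: len True D_def) blast
      show ?thesis
      \<comment> \<open>Here the junction lies strictly inside the list, at the odd index
        \<open>2 * j - 1\<close>, and \<open>D (2 * j - 1)\<close> decides between
        \<open>Y j\<close> and \<open>Y (Suc j)\<close>.\<close>
      proof (cases "0 < j \<and> j < m")
        case True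
        then have b: "Suc (2 * j - 1) < 2 * m" "Suc (2 * j - 1) = 2 * j" "odd (2 * j - 1)" "Suc (2 * j) < 2 * m"
          by auto
        have split: "xs \<in> X j \<longleftrightarrow> xs \<in> Y j" if "D (2 * j - 1)"
        proof -
          have "2 * j - 1 \<le> i \<longleftrightarrow> i = 2 * j - 1 \<or> 2 * j \<le> i" for i using b by auto
          then show ?thesis unfolding x y using that True by auto
        qed
        \<comment> \<open>Without the junction descent the alternating prefix grows by two entries:
          an ascent at index \<open>2 * j - 1\<close>, then the descent at \<open>2 * j\<close>
          supplied by the decreasing tail.\<close>
        have split': "xs \<in> X j \<longleftrightarrow> xs \<in> Y (Suc j)" if "\<not> D (2 * j - 1)"
        proof
          assume "xs \<in> X j"
          then have *: "Suc i < 2 * j \<Longrightarrow> D i \<longleftrightarrow> even i" "2 * j \<le> i \<Longrightarrow> D i" if "Suc i < 2 * m" for i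
            using x that by blast+
          have "D i \<longleftrightarrow> even i" if "Suc i < 2 * Suc j" "Suc i < 2 * m" for i
          proof -
            have "Suc i < 2 * j \<or> i = 2 * j - 1 \<or> i = 2 * j" using \<open>Suc i < 2 * Suc j\<close> by auto
            then consider "Suc i < 2 * j" | "i = 2 * j - 1" | "i = 2 * j" by blast
            then show ?thesis using * \<open>\<not> D (2 * j - 1)\<close> that b by cases auto
          qed
          then show "xs \<in> Y (Suc j)" unfolding y using True * by auto
        next
          assume "xs \<in> Y (Suc j)"
          then have *: "Suc i < 2 * Suc j \<Longrightarrow> D i \<longleftrightarrow> even i" "2 * Suc j - 1 \<le> i \<Longrightarrow> D i" if "Suc i < 2 * m" for i
            using y that by blast+
          have "D i" if "2 * j \<le> i" "Suc i < 2 * m" for i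
            using *[OF that(2)] that by (cases "i = 2 * j") auto
          then show "xs \<in> X j" unfolding x using * by auto
        qed
        have "xs \<notin> Y j" if "\<not> D (2 * j - 1)"
          unfolding y using that b by blast
        moreover have "xs \<notin> Y (Suc j)" if "D (2 * j - 1)"
        proof
          assume "xs \<in> Y (Suc j)"
          then have "D (2 * j - 1) \<longleftrightarrow> even (2 * j - 1)" unfolding y using b by simp
          then show False using that b by blast
        qed
        ultimately show ?thesis using split split' by blast
      next
        case False
        \<comment> \<open>At the two extremes there is no junction. A decreasing list starts with a
          descent, so \<open>X 0\<close> equals \<open>Y 1\<close>; for \<open>j = m\<close> the
          tail is empty and \<open>X m\<close> equals \<open>Y m\<close>.\<close>
        then consider "j = 0" | "j > 0" "j = m" using \<open>j \<le> m\<close> by linarith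
        then show ?thesis
        proof cases
          case 1
          have "Suc i < 2 * m \<Longrightarrow> i = 0 \<or> 1 \<le> i" for i by auto
          then have "xs \<in> X 0 \<longleftrightarrow> xs \<in> Y (Suc 0)"
            using assms x unfolding 1 y by (auto simp: le_less Suc_le_eq)
          then show ?thesis unfolding 1 y by simp
        next
          case 2
          have "xs \<in> X m \<longleftrightarrow> xs \<in> Y m"
            using assms x unfolding 2 y by auto
          then show ?thesis unfolding 2 y by simp
        qed
      qed
    qed
    then have "X j = Y j \<union> Y (Suc j)" "Y j \<inter> Y (Suc j) = {}" by blast+
    moreover have "finite (Y j)" for j
      unfolding Y_def by (rule finite_subset[OF _ finite_permutations_of_set[of ?A]]) auto
    ultimately show ?thesis by (simp add: card_Un_disjoint)
  qed
  have "(\<Sum>j\<le>m. (-1) ^ j * real ((2 * m choose (2 * j)) * card (down_ups {1..2 * j}))) =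
      (\<Sum>j\<le>m. (-1) ^ j * (real (card (Y j)) + real (card (Y (Suc j)))))"
  proof (rule sum.cong[OF refl])
    fix j assume "j \<in> {..m}"
    then have "(2 * m choose (2 * j)) * card (down_ups {1..2 * j}) = card (Y j) + card (Y (Suc j))"
      using X[of j] card_down_up_then_decreasing[of ?A "2 * j"] by (simp add: X_def)
    then show "(-1) ^ j * real ((2 * m choose (2 * j)) * card (down_ups {1..2 * j})) =
        (-1) ^ j * (real (card (Y j)) + real (card (Y (Suc j))))"
      by (simp only: of_nat_add)
  qed
  also have "\<dots> = 0"
    unfolding sum_alternating_telescope[of "\<lambda>j. real (card (Y j))"] by (simp add: Y_def)
  finally show ?thesis .
qed

text \<open>Andre's theorem for even lengths. The exponential generating function \<open>F\<close>
  of the counts is inverse to cosine: in degree \<open>2 * k\<close> the product gives, up to sign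
  and a factorial, the alternating sum that vanishes for \<open>k > 0\<close>.\<close>

lemma secant_number_eq_card_down_ups:
  "secant_number m = real (card (down_ups {1..2 * m}))"
proof -
  define e where "e j = real (card (down_ups {1..2 * j}))" for j
  define F :: "real fps" where "F = Abs_fps (\<lambda>n. if even n then e (n div 2) / fact n else 0)"
  have "fps_cos 1 * F = 1"
  proof (rule fps_ext)
    fix n
    show "fps_nth (fps_cos 1 * F) n = fps_nth 1 n"
    proof (cases "even n")
      case False
      \<comment> \<open>An odd degree is the sum of an even and an odd one, and neither series has
        odd coefficients.\<close>
      then have "fps_nth (F * fps_cos 1) n = 0"
        unfolding fps_mult_nth by (intro sum.neutral) (auto simp: F_def fps_cos_def)
      then show ?thesis using odd_pos[OF False] by (simp add: mult.commute)
    next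
      case True
      then obtain k where n: "n = 2 * k" by blast
      have "fps_nth (F * fps_cos 1) n = (\<Sum>i\<in>(\<lambda>j. 2 * j) ` {..k}. fps_nth F i * fps_nth (fps_cos 1) (n - i))"
        unfolding fps_mult_nth
        by (rule sum.mono_neutral_right) (auto simp: n F_def elim!: evenE)
      also have "\<dots> = (\<Sum>j\<le>k. fps_nth F (2 * j) * fps_nth (fps_cos 1) (2 * (k - j)))"
        by (subst sum.reindex) (auto simp: inj_on_def n diff_mult_distrib2)
      also have "\<dots> = (\<Sum>j\<le>k. (-1) ^ k / fact n * ((-1) ^ j * real ((2 * k choose (2 * j)) * card (down_ups {1..2 * j}))))"
      proof (rule sum.cong[OF refl])
        fix j assume "j \<in> {..k}"
        then have j: "j \<le> k" by simp
        \<comment> \<open>Splitting the cosine sign lets the factor depending on \<open>k\<close>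
          leave the sum.\<close>
        have sgn: "(-1) ^ (k - j) = ((-1) ^ k * (-1) ^ j :: real)"
          using j by (simp flip: power_add add: minus_one_power_iff)
        have "real (2 * k choose (2 * j)) = fact (2 * k) / (fact (2 * j) * fact (2 * (k - j)))"
          using binomial_fact[of "2 * j" "2 * k", where 'a = real] j by (simp add: diff_mult_distrib2)
        then show "fps_nth F (2 * j) * fps_nth (fps_cos 1) (2 * (k - j)) =
          (-1) ^ k / fact n * ((-1) ^ j * real ((2 * k choose (2 * j)) * card (down_ups {1..2 * j})))"
          by (simp add: F_def fps_cos_def e_def n sgn)
      qed
      also have "\<dots> = fps_nth 1 n"
      proof (cases "k = 0")
        case True
        moreover have "down_ups {} = {[]}" by (auto simp: down_ups_def down_up_list_def)
        ultimately show ?thesis by (simp add: n)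
      next
        case False
        then show ?thesis
          unfolding sum_distrib_left[symmetric] using sum_alternating_down_ups[of k] by (simp add: n)
      qed
      finally show ?thesis by (simp add: mult.commute)
    qed
  qed
  then have "inverse (fps_cos 1) = F"
    by (rule fps_inverse_unique)
  then show ?thesis
    by (simp add: secant_number_def F_def e_def)
qed

subsection \<open>Down-up lists behind three further entries\<close>

text \<open>Each \<open>k\<close>-subset has exactly one increasing listing.\<close>

lemma card_strict_sorted_lists:
  fixes S :: "'a::linorder set"
  assumes "finite S"
  shows "card {xs. sorted_wrt (<) xs \<and> set xs \<subseteq> S \<and> length xs = k} = card S choose k"
proof -
  have "bij_betw sorted_list_of_set {T. T \<subseteq> S \<and> card T = k}
      {xs. sorted_wrt (<) xs \<and> set xs \<subseteq> S \<and> length xs = k}"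
  proof (rule bij_betw_byWitness[of _ set])
    show "\<forall>T\<in>{T. T \<subseteq> S \<and> card T = k}. set (sorted_list_of_set T) = T"
      using finite_subset[OF _ assms] by simp
    show "\<forall>xs\<in>{xs. sorted_wrt (<) xs \<and> set xs \<subseteq> S \<and> length xs = k}. sorted_list_of_set (set xs) = xs"
      by (auto intro!: strict_sorted_equal)
    show "sorted_list_of_set ` {T. T \<subseteq> S \<and> card T = k} \<subseteq>
        {xs. sorted_wrt (<) xs \<and> set xs \<subseteq> S \<and> length xs = k}"
      using finite_subset[OF _ assms] by auto
    show "set ` {xs. sorted_wrt (<) xs \<and> set xs \<subseteq> S \<and> length xs = k} \<subseteq> {T. T \<subseteq> S \<and> card T = k}"
      by (auto simp: strict_sorted_iff distinct_card)
  qed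
  from bij_betw_same_card[OF this] show ?thesis
    using n_subsets[OF assms] by simp
qed

lemma card_increasing_pairs:
  fixes S :: "'a::linorder set"
  assumes "finite S"
  shows "card {(p, q). p \<in> S \<and> q \<in> S \<and> p < q} = card S choose 2"
proof -
  have "bij_betw (\<lambda>(p, q). [p, q]) {(p, q). p \<in> S \<and> q \<in> S \<and> p < q}
      {xs. sorted_wrt (<) xs \<and> set xs \<subseteq> S \<and> length xs = 2}"
    by (rule bij_betw_byWitness[of _ "\<lambda>xs. (xs ! 0, xs ! 1)"])
      (auto simp: numeral_2_eq_2 length_Suc_conv)
  from bij_betw_same_card[OF this] show ?thesis
    using card_strict_sorted_lists[OF assms] by simp
qed

lemma card_increasing_triples:
  fixes S :: "'a::linorder set"
  assumes "finite S"
  shows "card {(p, q, r). p \<in> S \<and> q \<in> S \<and> r \<in> S \<and> p < q \<and> q < r} = card S choose 3"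
proof -
  have "bij_betw (\<lambda>(p, q, r). [p, q, r]) {(p, q, r). p \<in> S \<and> q \<in> S \<and> r \<in> S \<and> p < q \<and> q < r}
      {xs. sorted_wrt (<) xs \<and> set xs \<subseteq> S \<and> length xs = 3}"
    by (rule bij_betw_byWitness[of _ "\<lambda>xs. (xs ! 0, xs ! 1, xs ! 2)"])
      (auto simp: numeral_3_eq_3 length_Suc_conv)
  from bij_betw_same_card[OF this] show ?thesis
    using card_strict_sorted_lists[OF assms] by simp
qed

text \<open>Classify the lists by their fourth entry \<open>v\<close>. Since \<open>C\<close> forces
  exactly \<open>a\<close> of the first three entries below \<open>v\<close>, the number of tails
  depends on \<open>v\<close> alone and not on the three entries chosen.\<close>

lemma card_down_ups_behind_three:
  fixes C :: "nat \<Rightarrow> nat \<Rightarrow> nat \<Rightarrow> nat \<Rightarrow> bool"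
  assumes N: "N \<ge> 4"
    and C: "\<And>y x b v. C y x b v \<Longrightarrow> distinct [y, x, b, v] \<and> card {u \<in> {y, x, b}. u < v} = a"
  shows "card {ws \<in> permutations_of_set {1..N}.
      down_up_list (drop 3 ws) \<and> C (ws ! 0) (ws ! 1) (ws ! 2) (ws ! 3)} =
    (\<Sum>v\<in>{1..N}. card {(y, x, b). {y, x, b} \<subseteq> {1..N} \<and> C y x b v} * entringer (N - 4) (v - 1 - a))"
proof -
  let ?K = "\<lambda>v. {(y, x, b). {y, x, b} \<subseteq> {1..N} \<and> C y x b v}"
  let ?Z = "\<lambda>v (y, x, b). {zs \<in> down_ups ({1..N} - {y, x, b}). hd zs = v}"
  let ?S = "SIGMA v:{1..N}. SIGMA t:?K v. ?Z v t"
  let ?F = "\<lambda>(v::nat, (y::nat, x::nat, b::nat), zs). y # x # b # zs"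
  let ?W = "{ws \<in> permutations_of_set {1..N}.
      down_up_list (drop 3 ws) \<and> C (ws ! 0) (ws ! 1) (ws ! 2) (ws ! 3)}"
  have finK: "finite (?K v)" for v
    by (rule finite_subset[of _ "{1..N} \<times> {1..N} \<times> {1..N}"]) auto
  have cardZ: "card (?Z v t) = entringer (N - 4) (v - 1 - a)" if "v \<in> {1..N}" "t \<in> ?K v" for v t
  proof -
    obtain y x b where t: "t = (y, x, b)" by (cases t)
    have T: "{y, x, b} \<subseteq> {1..N}" and Cv: "C y x b v" using that t by auto
    have d: "distinct [y, x, b, v]" and a: "card {u \<in> {y, x, b}. u < v} = a" using C[OF Cv] by auto
    have "card ({1..N} - {y, x, b}) = N - 3"
      using d T by (subst card_Diff_subset) auto
    moreover have "card {u \<in> {1..N} - {y, x, b}. u < v} = v - 1 - a"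
    proof -
      \<comment> \<open>The removed values below \<open>v\<close> are \<open>a\<close> elements of
        \<open>{1..<v}\<close>, so the subtraction is not truncated.\<close>
      have "{u \<in> {1..N} - {y, x, b}. u < v} = {1..<v} - {u \<in> {y, x, b}. u < v}"
        using that(1) by auto
      also have "card \<dots> = v - 1 - a"
        using T a by (subst card_Diff_subset) auto
      finally show ?thesis .
    qed
    moreover have "card {zs \<in> down_ups ({1..N} - {y, x, b}). hd zs = v} =
        entringer (card ({1..N} - {y, x, b}) - 1) (card {u \<in> {1..N} - {y, x, b}. u < v})"
      using that(1) d by (intro card_down_ups_hd_entringer) auto
    moreover have "N - 3 - 1 = N - 4" by simp
    ultimately show ?thesis by (simp only: t prod.case)
  qed
  \<comment> \<open>At least \<open>N - 3\<close> values remain for the tail, so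
    \<open>N \<ge> 4\<close> makes it nonempty and its \<open>hd\<close> is the entry of the whole
    list at index 3.\<close>
  have ne: "zs \<noteq> []" if "zs \<in> ?Z v t" "t \<in> ?K v" for zs v t
  proof -
    obtain y x b where t: "t = (y, x, b)" by (cases t)
    have "card ({1..N} - {y, x, b}) \<ge> N - card {y, x, b}"
      using diff_card_le_card_Diff[of "{y, x, b}" "{1..N}"] by simp
    moreover have "card {y, x, b} \<le> 3" by (simp add: card_insert_if)
    ultimately have "length zs > 0"
      using that N down_ups_length[of zs "{1..N} - {y, x, b}"] by (simp add: t)
    then show ?thesis by simp
  qed
  have "bij_betw ?F ?S ?W"
  proof (rule bij_betw_byWitness[of _ "\<lambda>ws. (ws ! 3, (ws ! 0, ws ! 1, ws ! 2), drop 3 ws)"])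
    show "\<forall>s\<in>?S. (\<lambda>ws. (ws ! 3, (ws ! 0, ws ! 1, ws ! 2), drop 3 ws)) (?F s) = s"
      using ne by (fastforce simp: hd_conv_nth numeral_2_eq_2 numeral_3_eq_3)
    have split: "ws = ws ! 0 # ws ! 1 # ws ! 2 # drop 3 ws \<and> drop 3 ws \<noteq> []" if "ws \<in> ?W" for ws
    proof -
      have "length ws = N" using that length_finite_permutations_of_set[of ws "{1..N}"] by simp
      moreover from this obtain y x b zs where "ws = y # x # b # zs"
        using N by (cases ws; cases "tl ws"; cases "tl (tl ws)") auto
      ultimately show ?thesis using N by (auto simp: numeral_2_eq_2 numeral_3_eq_3)
    qed
    show "\<forall>ws\<in>?W. ?F (ws ! 3, (ws ! 0, ws ! 1, ws ! 2), drop 3 ws) = ws"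
      using split by simp
    show "?F ` ?S \<subseteq> ?W"
    proof (rule image_subsetI)
      fix s assume s: "s \<in> ?S"
      then obtain v y x b zs where s_eq: "s = (v, (y, x, b), zs)" and T: "{y, x, b} \<subseteq> {1..N}" and Cv: "C y x b v"
        and zs: "zs \<in> down_ups ({1..N} - {y, x, b})" "hd zs = v" by auto
      have "zs \<noteq> []" using ne[of zs v "(y, x, b)"] T Cv zs by simp
      then have "zs ! 0 = v" using zs by (simp add: hd_conv_nth)
      moreover have z: "set zs = {1..N} - {y, x, b}" "distinct zs" "down_up_list zs"
        using zs(1) by (simp_all add: down_ups_def permutations_of_set_def)
      moreover have "set (y # x # b # zs) = {1..N}"
        unfolding list.set z(1) using T by blast
      moreover have "distinct (y # x # b # zs)"
        using C[OF Cv] z(1,2) by simp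
      ultimately show "?F s \<in> ?W"
        using Cv by (simp add: s_eq numeral_2_eq_2 numeral_3_eq_3 permutations_of_set_def)
    qed
    show "(\<lambda>ws. (ws ! 3, (ws ! 0, ws ! 1, ws ! 2), drop 3 ws)) ` ?W \<subseteq> ?S"
    proof (rule image_subsetI)
      fix ws assume ws: "ws \<in> ?W"
      define y x b zs where "y = ws ! 0" "x = ws ! 1" "b = ws ! 2" "zs = drop 3 ws"
      have eq: "ws = y # x # b # zs" and "zs \<noteq> []"
        using split[OF ws] by (simp_all add: y_x_b_zs_def)
      have d: "distinct (y # x # b # zs)" and s: "set (y # x # b # zs) = {1..N}"
        using ws unfolding eq by (auto simp: permutations_of_set_def)
      have v: "ws ! 3 = hd zs" unfolding eq using \<open>zs \<noteq> []\<close> by (simp add: hd_conv_nth numeral_3_eq_3)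
      have "hd zs \<in> {1..N}" using s \<open>zs \<noteq> []\<close> by (cases zs) auto
      moreover have "set zs = {1..N} - {y, x, b}" using s d by auto
      moreover have "{y, x, b} \<subseteq> {1..N}" using s by auto
      moreover have "C y x b (hd zs)" "down_up_list zs" using ws v by (simp_all add: y_x_b_zs_def)
      ultimately show "(ws ! 3, (ws ! 0, ws ! 1, ws ! 2), drop 3 ws) \<in> ?S"
        using d unfolding v y_x_b_zs_def(4)[symmetric] y_x_b_zs_def(1-3)[symmetric]
        by (auto simp: down_ups_def permutations_of_set_def)
    qed
  qed
  then have "card ?W = card ?S" by (rule bij_betw_same_card[symmetric])
  also have "\<dots> = (\<Sum>v\<in>{1..N}. card (SIGMA t:?K v. ?Z v t))"
    using finK finite_down_ups
    by (intro card_SigmaI ballI finite_SigmaI) (auto intro: finite_subset[OF _ finite_down_ups])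
  also have "\<dots> = (\<Sum>v\<in>{1..N}. card (?K v) * entringer (N - 4) (v - 1 - a))"
  proof (rule sum.cong[OF refl])
    fix v assume v: "v \<in> {1..N}"
    have "card (SIGMA t:?K v. ?Z v t) = (\<Sum>t\<in>?K v. card (?Z v t))"
      using finK by (intro card_SigmaI) (auto intro: finite_subset[OF _ finite_down_ups])
    also have "\<dots> = (\<Sum>t\<in>?K v. entringer (N - 4) (v - 1 - a))"
      using cardZ[OF v] by (rule sum.cong[OF refl])
    finally show "card (SIGMA t:?K v. ?Z v t) = card (?K v) * entringer (N - 4) (v - 1 - a)" by simp
  qed
  finally show ?thesis .
qed

text \<open>Substitute \<open>v = i + a + 1\<close>. The values of \<open>v\<close> lost at the ends
  contribute nothing: one of the two binomials vanishes, or \<open>v = a + 1\<close> and the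
  Entringer number has second argument 0.\<close>

lemma sum_binomial_entringer_shift:
  assumes "a \<le> 3" "N > 4"
  shows "(\<Sum>v\<in>{1..N}. (((v - 1) choose a) * ((N - v) choose (3 - a))) * entringer (N - 4) (v - 1 - a)) =
    (\<Sum>i = 1..N - 4. ((i + a) choose a) * ((N - 1 - a - i) choose (3 - a)) * entringer (N - 4) i)"
proof -
  let ?f = "\<lambda>v. (((v - 1) choose a) * ((N - v) choose (3 - a))) * entringer (N - 4) (v - 1 - a)"
  have "sum ?f {1..N} = sum ?f {1 + (a + 1)..(N - 4) + (a + 1)}"
  proof (rule sum.mono_neutral_right)
    show "\<forall>v\<in>{1..N} - {1 + (a + 1)..N - 4 + (a + 1)}. ?f v = 0"
    proof
      fix v assume "v \<in> {1..N} - {1 + (a + 1)..N - 4 + (a + 1)}"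
      then have "v - 1 < a \<or> v = a + 1 \<or> N - v < 3 - a" using assms by auto
      then show "?f v = 0" using entringer_0_right[of "N - 4"] assms by (auto simp: binomial_eq_0)
    qed
  qed (use assms in auto)
  also have "\<dots> = (\<Sum>i = 1..N - 4. ?f (i + (a + 1)))"
    by (rule sum.shift_bounds_cl_nat_ivl)
  also have "\<dots> = (\<Sum>i = 1..N - 4. ((i + a) choose a) * ((N - 1 - a - i) choose (3 - a)) * entringer (N - 4) i)"
    by (intro sum.cong refl) (simp add: algebra_simps)
  finally show ?thesis .
qed

subsection \<open>Puzzles as lists\<close>

abbreviation mat22 :: "nat \<Rightarrow> nat \<Rightarrow> nat \<Rightarrow> nat \<Rightarrow> nat mat" where
  "mat22 a b c d \<equiv> mat_of_rows_list 2 [[a, b], [c, d]]"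

lemma less_two_iff: "i < (2::nat) \<longleftrightarrow> i = 0 \<or> i = 1"
  by auto

lemma mat22_eq_iff: "mat22 a b c d = mat22 a' b' c' d' \<longleftrightarrow> a = a' \<and> b = b' \<and> c = c' \<and> d = d'"
proof
  assume eq: "mat22 a b c d = mat22 a' b' c' d'"
  have "mat22 a b c d $$ (i, j) = mat22 a' b' c' d' $$ (i, j)" for i j by (simp add: eq)
  from this[of 0 0] this[of 0 1] this[of 1 0] this[of 1 1]
  show "a = a' \<and> b = b' \<and> c = c' \<and> d = d'" by (simp add: mat_of_rows_list_def)
qed simp

lemma eq_mat22:
  assumes "Q \<in> carrier_mat 2 2"
  shows "Q = mat22 (Q $$ (0, 0)) (Q $$ (0, 1)) (Q $$ (1, 0)) (Q $$ (1, 1))"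
  by (rule eq_matI) (use assms in \<open>auto simp: mat_of_rows_list_def less_Suc_eq less_two_iff\<close>)

lemma elements_mat22: "elements_mat (mat22 a b c d) = {a, b, c, d}"
  by (simp add: elements_mat_def mat_of_rows_list_def upt_rec)

lemma card_Collect_eq_sum_of_bool:
  "finite S \<Longrightarrow> card {u \<in> S. P u} = (\<Sum>u\<in>S. of_bool (P u))"
  by (simp add: sum_of_bool_eq Collect_conj_eq)

text \<open>The rank used by \<open>reduction\<close>, written as a sum of truth values so that
  known comparisons between the entries determine it directly.\<close>

definition rank4 :: "nat \<Rightarrow> nat \<Rightarrow> nat \<Rightarrow> nat \<Rightarrow> nat \<Rightarrow> nat" where
  "rank4 a b c d x = of_bool (a \<le> x) + of_bool (b \<le> x) + of_bool (c \<le> x) + of_bool (d \<le> x)"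

text \<open>Ranks are weakly increasing in the argument, so a strict inequality between ranks pulls
  back to the entries. This recovers the order of the entries from the reduced piece.\<close>

lemma less_if_rank4_less: "rank4 a b c d x < rank4 a b c d y \<Longrightarrow> x < y"
proof (rule ccontr)
  assume "rank4 a b c d x < rank4 a b c d y" "\<not> x < y"
  moreover have "rank4 a b c d y \<le> rank4 a b c d x"
    unfolding rank4_def using \<open>\<not> x < y\<close> by (intro add_mono) auto
  ultimately show False by simp
qed

lemma reduction_mat22:
  assumes "distinct [a, b, c, d]"
  shows "reduction (mat22 a b c d) =
    mat22 (rank4 a b c d a) (rank4 a b c d b) (rank4 a b c d c) (rank4 a b c d d)"
proof -
  have "card {y \<in> {a, b, c, d}. y \<le> x} = rank4 a b c d x" for x
  proof -
    have "card {y \<in> {a, b, c, d}. y \<le> x} = (\<Sum>y\<in>{a, b, c, d}. of_bool (y \<le> x))"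
      by (rule card_Collect_eq_sum_of_bool) simp
    also have "\<dots> = rank4 a b c d x" using assms by (simp add: rank4_def)
    finally show ?thesis .
  qed
  then show ?thesis
    unfolding reduction_def elements_mat22
    by (subst eq_mat22) (simp_all add: mat_of_rows_list_def carrier_matI)
qed

text \<open>The inequalities describe the fence \<open>a > c < b > d\<close>, and the five pieces
  are precisely its five linear extensions.\<close>

lemma reduction_mat22_in_As:
  assumes "distinct [a, b, c, d]"
  shows "reduction (mat22 a b c d) \<in> {A\<^sub>1, A\<^sub>2, A\<^sub>3, A\<^sub>4, A\<^sub>5} \<longleftrightarrow> c < a \<and> c < b \<and> d < b"
    (is "?l \<longleftrightarrow> ?r")
proof -
  note red = reduction_mat22[OF assms] A\<^sub>1_def A\<^sub>2_def A\<^sub>3_def A\<^sub>4_def A\<^sub>5_def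
    insert_iff empty_iff mat22_eq_iff
  note lt = less_if_rank4_less[of a b c d]
  show ?thesis
  proof
    assume ?l
    then show ?r
      unfolding red using lt[of c a] lt[of c b] lt[of d b] by auto
  next
    assume ?r
    \<comment> \<open>These are the three pairs that the fence leaves open; each consistent choice
      gives one of the five pieces.\<close>
    moreover have "a < b \<or> b < a" "c < d \<or> d < c" "a < d \<or> d < a" using assms by auto
    ultimately show ?l
      unfolding red rank4_def by (elim disjE conjE) simp_all
  qed
qed

text \<open>Each chain lists the positions by increasing entry. All six have \<open>c < a\<close>
  and \<open>b < d\<close>: the first column descends and the second ascends.\<close>

lemma reduction_mat22_eq_Bs:
  assumes "distinct [a, b, c, d]"
  shows "reduction (mat22 a b c d) = B\<^sub>1 \<longleftrightarrow> c < b \<and> b < d \<and> d < a"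
    and "reduction (mat22 a b c d) = B\<^sub>2 \<longleftrightarrow> c < b \<and> b < a \<and> a < d"
    and "reduction (mat22 a b c d) = B\<^sub>3 \<longleftrightarrow> c < a \<and> a < b \<and> b < d"
    and "reduction (mat22 a b c d) = B\<^sub>4 \<longleftrightarrow> b < c \<and> c < a \<and> a < d"
    and "reduction (mat22 a b c d) = B\<^sub>5 \<longleftrightarrow> b < c \<and> c < d \<and> d < a"
    and "reduction (mat22 a b c d) = B\<^sub>6 \<longleftrightarrow> b < d \<and> d < c \<and> c < a"
proof -
  note red = reduction_mat22[OF assms] mat22_eq_iff
  note lt = less_if_rank4_less[of a b c d]
  show "reduction (mat22 a b c d) = B\<^sub>1 \<longleftrightarrow> c < b \<and> b < d \<and> d < a"
    unfolding red B\<^sub>1_def using lt[of c b] lt[of b d] lt[of d a] 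
    by (rule_tac iffI) (simp, simp add: rank4_def)
  show "reduction (mat22 a b c d) = B\<^sub>2 \<longleftrightarrow> c < b \<and> b < a \<and> a < d"
    unfolding red B\<^sub>2_def using lt[of c b] lt[of b a] lt[of a d] 
    by (rule_tac iffI) (simp, simp add: rank4_def)
  show "reduction (mat22 a b c d) = B\<^sub>3 \<longleftrightarrow> c < a \<and> a < b \<and> b < d"
    unfolding red B\<^sub>3_def using lt[of c a] lt[of a b] lt[of b d] 
    by (rule_tac iffI) (simp, simp add: rank4_def)
  show "reduction (mat22 a b c d) = B\<^sub>4 \<longleftrightarrow> b < c \<and> c < a \<and> a < d"
    unfolding red B\<^sub>4_def using lt[of b c] lt[of c a] lt[of a d] 
    by (rule_tac iffI) (simp, simp add: rank4_def)
  show "reduction (mat22 a b c d) = B\<^sub>5 \<longleftrightarrow> b < c \<and> c < d \<and> d < a"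
    unfolding red B\<^sub>5_def using lt[of b c] lt[of c d] lt[of d a] 
    by (rule_tac iffI) (simp, simp add: rank4_def)
  show "reduction (mat22 a b c d) = B\<^sub>6 \<longleftrightarrow> b < d \<and> d < c \<and> c < a"
    unfolding red B\<^sub>6_def using lt[of b d] lt[of d c] lt[of c a] 
    by (rule_tac iffI) (simp, simp add: rank4_def)
qed

text \<open>Columns are read from left to right with the top entry first, so piece \<open>k\<close>
  occupies the positions \<open>2 * k\<close> to \<open>2 * k + 3\<close>.\<close>

lemma num_puzzles_eq_card_lists:
  "num_puzzles n P = card {ws \<in> permutations_of_set {1..2 * n + 2}. \<forall>k<n.
    reduction (mat22 (ws ! (2 * k)) (ws ! (2 * k + 2)) (ws ! (2 * k + 1)) (ws ! (2 * k + 3))) \<in> P}"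
proof -
  let ?N = "2 * n + 2" and ?I = "{0..<2} \<times> {0..<n + 1}"
  let ?c = "\<lambda>k::nat. (k mod 2, k div 2)"
  let ?F = "\<lambda>M::nat mat. map (\<lambda>k. M $$ ?c k) [0..<?N]"
  let ?G = "\<lambda>ws::nat list. mat 2 (n + 1) (\<lambda>(i, j). ws ! (2 * j + i))"
  let ?Y = "{ws \<in> permutations_of_set {1..?N}. \<forall>k<n.
    reduction (mat22 (ws ! (2 * k)) (ws ! (2 * k + 2)) (ws ! (2 * k + 1)) (ws ! (2 * k + 3))) \<in> P}"
  have c: "bij_betw ?c {..<?N} ?I"
    by (rule bij_betw_byWitness[of _ "\<lambda>(i, j). 2 * j + i"]) (auto simp: less_two_iff)
  have support: "is_support P M \<longleftrightarrow> (\<forall>k<n. reduction (mat22 (?F M ! (2 * k)) (?F M ! (2 * k + 2))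
      (?F M ! (2 * k + 1)) (?F M ! (2 * k + 3))) \<in> P)" if M: "M \<in> carrier_mat 2 (n + 1)" for M
  proof -
    have "piece M k = mat22 (?F M ! (2 * k)) (?F M ! (2 * k + 2)) (?F M ! (2 * k + 1)) (?F M ! (2 * k + 3))"
      if "k < n" for k
    proof -
      have "(2 * k + 3) div 2 = k + 1" "(2 * k + 3) mod 2 = 1" by presburger+
      then show ?thesis
        using that by (subst eq_mat22) (simp_all add: piece_def del: upt_Suc)
    qed
    moreover have "dim_col M = n + 1" using M by simp
    ultimately show ?thesis unfolding is_support_def pieces_def by auto
  qed
  have puzzle: "standard_puzzle n M \<longleftrightarrow> ?F M \<in> permutations_of_set {1..?N}"
    if M: "M \<in> carrier_mat 2 (n + 1)" for M
  proof -
    have "standard_puzzle n M \<longleftrightarrow> bij_betw (\<lambda>ij. M $$ ij) ?I {1..?N}"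
      using M by (simp add: standard_puzzle_def)
    \<comment> \<open>The map \<open>?c\<close> from list positions to matrix indices is a
      bijection, so precomposing with it does not affect bijectivity.\<close>
    also have "\<dots> \<longleftrightarrow> bij_betw ((\<lambda>ij. M $$ ij) \<circ> ?c) {..<?N} {1..?N}"
      by (rule bij_betw_comp_iff[OF c])
    also have "\<dots> \<longleftrightarrow> ?F M \<in> permutations_of_set {1..?N}"
      by (auto simp: bij_betw_def permutations_of_set_def distinct_map comp_def lessThan_atLeast0 simp del: upt_Suc)
    finally show ?thesis .
  qed
  have FG: "?F (?G ws) = ws" if "ws \<in> permutations_of_set {1..?N}" for ws
    using length_finite_permutations_of_set[OF that]
  proof (intro nth_equalityI)
    fix i assume "i < length (?F (?G ws))"
    then have "i < ?N" "i div 2 < n + 1" by (auto simp del: upt_Suc)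
    then show "?F (?G ws) ! i = ws ! i" by (simp del: upt_Suc)
  qed (simp del: upt_Suc)
  have "bij_betw ?F (puzzles n P) ?Y"
  proof (rule bij_betw_byWitness[of _ ?G])
    show "\<forall>M\<in>puzzles n P. ?G (?F M) = M"
      by (auto simp: puzzles_def standard_puzzle_def less_two_iff simp del: upt_Suc intro!: eq_matI)
    show "\<forall>ws\<in>?Y. ?F (?G ws) = ws" using FG by blast
    show "?F ` puzzles n P \<subseteq> ?Y"
    proof (rule image_subsetI)
      fix M assume M: "M \<in> puzzles n P"
      then have "M \<in> carrier_mat 2 (n + 1)" by (simp add: puzzles_def standard_puzzle_def)
      from puzzle[OF this] support[OF this] show "?F M \<in> ?Y" using M by (simp add: puzzles_def)
    qed
    show "?G ` ?Y \<subseteq> puzzles n P"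
    proof (rule image_subsetI)
      fix ws assume ws: "ws \<in> ?Y"
      have "?G ws \<in> carrier_mat 2 (n + 1)" by simp
      from puzzle[OF this] support[OF this] show "?G ws \<in> puzzles n P"
        using ws FG[of ws] by (simp add: puzzles_def)
    qed
  qed
  then show ?thesis unfolding num_puzzles_def by (rule bij_betw_same_card)
qed

section \<open>Puzzles with one additional piece allowed\<close>

text \<open>The triple for \<open>k\<close> is what an \<open>A\<close> piece says about descents.
  Consecutive triples overlap in the descent of a shared column; the last index \<open>2 * m\<close>
  is covered only by the triple for \<open>m - 1\<close>, hence \<open>m > 0\<close>.\<close>

lemma alternation_iff_pairs:
  fixes D :: "nat \<Rightarrow> bool"
  assumes "m > 0"
  shows "(\<forall>k<m. D (2 * k) \<and> \<not> D (2 * k + 1) \<and> D (2 * k + 2)) \<longleftrightarrow>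
    (\<forall>i<2 * m + 1. D i \<longleftrightarrow> even i)" (is "?l \<longleftrightarrow> ?r")
proof
  assume l: ?l
  show ?r
  proof (intro allI impI)
    fix i assume i: "i < 2 * m + 1"
    show "D i \<longleftrightarrow> even i"
    proof (cases "i = 2 * m")
      case True
      then show ?thesis using l[rule_format, of "m - 1"] assms by (cases m) auto
    next
      case False
      then have "i div 2 < m" using i by auto
      with l have "D (2 * (i div 2))" "\<not> D (2 * (i div 2) + 1)" by auto
      then show ?thesis by (cases "even i") auto
    qed
  qed
next
  assume ?r
  then show ?l by auto
qed

text \<open>Reversal exchanges ascents and descents, and for odd length it also exchanges even and
  odd step positions, so the pattern survives.\<close>

lemma down_up_list_rev:
  assumes "odd (length xs)"
  shows "down_up_list (rev xs) \<longleftrightarrow> down_up_list xs"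
proof -
  have "down_up_list (rev ys)" if ys: "odd (length ys)" "down_up_list ys" for ys
    unfolding down_up_list_def
  proof (intro allI impI)
    fix i assume "Suc i < length (rev ys)"
    then obtain j where j: "length ys = i + j + 2" by (auto simp: less_iff_Suc_add)
    have "rev ys ! i = ys ! Suc j" "rev ys ! Suc i = ys ! j"
      using j by (simp_all add: rev_nth)
    moreover have "even j \<longleftrightarrow> odd i" using ys(1) j by auto
    ultimately show "if even i then rev ys ! Suc i < rev ys ! i else rev ys ! i < rev ys ! Suc i"
      using ys(2) j unfolding down_up_list_def by auto
  qed
  from this[of xs] this[of "rev xs"] show ?thesis using assms by auto
qed

lemma card_less_in_three:
  fixes v :: "'a::linorder"
  assumes "distinct [y, x, b]"
  shows "card {u \<in> {y, x, b}. u < v} = of_bool (y < v) + of_bool (x < v) + of_bool (b < v)"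
proof -
  have "card {u \<in> {y, x, b}. u < v} = (\<Sum>u\<in>{y, x, b}. of_bool (u < v))"
    by (rule card_Collect_eq_sum_of_bool) simp
  then show ?thesis using assms by simp
qed

text \<open>The second column of a piece \<open>B\<^sub>j\<close> ascends while the first column of every allowed piece
  descends, so \<open>B\<^sub>j\<close> can only occur as the last piece of a puzzle.\<close>

lemma num_puzzles_insert:
  fixes C :: "nat \<Rightarrow> nat \<Rightarrow> nat \<Rightarrow> nat \<Rightarrow> bool"
  assumes n: "n \<ge> 2" and a: "a \<le> 3"
    and B: "\<And>y x b v. distinct [v, x, b, y] \<Longrightarrow> reduction (mat22 v x b y) = B \<longleftrightarrow> C y x b v"
    and C: "\<And>y x b v. C y x b v \<Longrightarrow> distinct [y, x, b, v] \<and> b < v \<and> x < y \<and>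
      of_bool (y < v) + of_bool (x < v) + of_bool (b < v) = a"
    and count: "\<And>v N. v \<in> {1..N} \<Longrightarrow> card {(y, x, b). {y, x, b} \<subseteq> {1..N} \<and> C y x b v} =
      ((v - 1) choose a) * ((N - v) choose (3 - a))"
  shows "real (num_puzzles n ({A\<^sub>1, A\<^sub>2, A\<^sub>3, A\<^sub>4, A\<^sub>5} \<union> {B})) =
    real (\<Sum>i = 1..2 * n - 2. ((i + a) choose a) * ((2 * n + 1 - a - i) choose (3 - a)) * entringer (2 * n - 2) i)
      + secant_number (n + 1)"
proof -
  let ?N = "2 * n + 2"
  let ?R = "\<lambda>ws k. reduction (mat22 (ws ! (2 * k)) (ws ! (2 * k + 2)) (ws ! (2 * k + 1)) (ws ! (2 * k + 3)))"
  \<comment> \<open>These are the puzzles ending in \<open>B\<close>: the prefix stops at the upper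
    left entry \<open>v\<close> of the last piece, and \<open>C\<close> governs the last four
    entries.\<close>
  let ?L = "{ws \<in> permutations_of_set {1..?N}. down_up_list (take (2 * n - 1) ws) \<and>
    C (ws ! (2 * n + 1)) (ws ! (2 * n)) (ws ! (2 * n - 1)) (ws ! (2 * n - 2))}"
  have mem: "((\<forall>k<n. ?R ws k \<in> {A\<^sub>1, A\<^sub>2, A\<^sub>3, A\<^sub>4, A\<^sub>5} \<union> {B}) \<longleftrightarrow> ws \<in> down_ups {1..?N} \<or> ws \<in> ?L) \<and>
      \<not> (ws \<in> down_ups {1..?N} \<and> ws \<in> ?L)"
    if ws: "ws \<in> permutations_of_set {1..?N}" for ws
  proof -
    have d: "distinct ws" and len: "length ws = ?N"
      using ws length_finite_permutations_of_set[OF ws] by (auto simp: permutations_of_set_def)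
    define D where "D i \<longleftrightarrow> ws ! Suc i < ws ! i" for i
    define A where "A k \<longleftrightarrow> D (2 * k) \<and> \<not> D (2 * k + 1) \<and> D (2 * k + 2)" for k
    define Cl where "Cl k \<longleftrightarrow> C (ws ! (2 * k + 3)) (ws ! (2 * k + 2)) (ws ! (2 * k + 1)) (ws ! (2 * k))" for k
    have R: "?R ws k \<in> {A\<^sub>1, A\<^sub>2, A\<^sub>3, A\<^sub>4, A\<^sub>5} \<union> {B} \<longleftrightarrow> A k \<or> Cl k" if "k < n" for k
    proof -
      have dist: "distinct [ws ! (2 * k), ws ! (2 * k + 2), ws ! (2 * k + 1), ws ! (2 * k + 3)]"
        using that d by (simp add: len nth_eq_iff_index_eq)
      then have "A k \<longleftrightarrow> ws ! (2 * k + 1) < ws ! (2 * k) \<and> ws ! (2 * k + 1) < ws ! (2 * k + 2) \<and>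
          ws ! (2 * k + 3) < ws ! (2 * k + 2)"
        by (auto simp: A_def D_def numeral_3_eq_3)
      then show ?thesis
        using reduction_mat22_in_As[OF dist] B[OF dist] unfolding Cl_def Un_iff singleton_iff by simp
    qed
    \<comment> \<open>The conditions \<open>b < v\<close> and \<open>x < y\<close> in
      \<open>C\<close> say that the first column of the extra piece descends and its second
      ascends.\<close>
    have Cl: "D (2 * k) \<and> \<not> D (2 * k + 2)" if "Cl k" for k
      using C[OF that[unfolded Cl_def]] by (auto simp: D_def numeral_3_eq_3)
    have du: "down_up_list (take j ws) \<longleftrightarrow> (\<forall>i. Suc i < j \<longrightarrow> (D i \<longleftrightarrow> even i))" if "j \<le> ?N" for j
      unfolding down_up_list_iff_descents[OF d] D_def using that len by auto
    have full: "ws \<in> down_ups {1..?N} \<longleftrightarrow> (\<forall>k<n. A k)"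
    proof -
      have "ws \<in> down_ups {1..?N} \<longleftrightarrow> (\<forall>i<2 * n + 1. D i \<longleftrightarrow> even i)"
        using du[of ?N] ws len by (auto simp: down_ups_def)
      then show ?thesis unfolding A_def using alternation_iff_pairs[of n D] n by simp
    qed
    have last: "ws \<in> ?L \<longleftrightarrow> (\<forall>k<n - 1. A k) \<and> Cl (n - 1)"
    proof -
      obtain m where "n = Suc m" using n by (cases n) auto
      then have "ws \<in> ?L \<longleftrightarrow> down_up_list (take (2 * n - 1) ws) \<and> Cl (n - 1)"
        using ws by (simp add: Cl_def numeral_3_eq_3)
      also have "\<dots> \<longleftrightarrow> (\<forall>i<2 * (n - 1) + 1. D i \<longleftrightarrow> even i) \<and> Cl (n - 1)"
      proof -
        \<comment> \<open>The prefix of length \<open>2 * n - 1\<close> says nothing about the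
          descent in the first column of the last piece; \<open>Cl (n - 1)\<close> supplies
          it.\<close>
        have "(\<forall>i<2 * (n - 1) + 1. D i \<longleftrightarrow> even i) \<longleftrightarrow>
            (\<forall>i. Suc i < 2 * n - 1 \<longrightarrow> (D i \<longleftrightarrow> even i)) \<and> D (2 * (n - 1))"
        proof -
          have "i < 2 * (n - 1) + 1 \<longleftrightarrow> Suc i < 2 * n - 1 \<or> i = 2 * (n - 1)" for i using n by auto
          then show ?thesis by auto
        qed
        then show ?thesis using du[of "2 * n - 1"] Cl[of "n - 1"] by auto
      qed
      also have "\<dots> \<longleftrightarrow> (\<forall>k<n - 1. A k) \<and> Cl (n - 1)"
        unfolding A_def using alternation_iff_pairs[of "n - 1" D] n by simp
      finally show ?thesis .
    qed
    \<comment> \<open>Any allowed piece starts with a descending column, which contradicts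
      \<open>Cl\<close> for the piece before it.\<close>
    have next_D: "D (2 * k + 2)" if "A (Suc k) \<or> Cl (Suc k)" for k
      using that Cl[of "Suc k"] by (auto simp: A_def)
    have "(\<forall>k<n. A k \<or> Cl k) \<longleftrightarrow> (\<forall>k<n - 1. A k) \<and> (A (n - 1) \<or> Cl (n - 1))"
    proof (intro iffI conjI allI impI)
      fix k assume *: "\<forall>k<n. A k \<or> Cl k" "k < n - 1"
      then have "D (2 * k + 2)" "A k \<or> Cl k" using next_D[of k] by auto
      then show "A k" using Cl by blast
    next
      assume "\<forall>k<n. A k \<or> Cl k"
      then show "A (n - 1) \<or> Cl (n - 1)" using n by simp
    next
      fix k assume "(\<forall>k<n - 1. A k) \<and> (A (n - 1) \<or> Cl (n - 1))" "k < n"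
      then show "A k \<or> Cl k" by (cases "k = n - 1") auto
    qed
    moreover have "(\<forall>k<n. A k) \<longleftrightarrow> (\<forall>k<n - 1. A k) \<and> A (n - 1)"
    proof -
      have "k < n \<longleftrightarrow> k < n - 1 \<or> k = n - 1" for k using n by auto
      then show ?thesis by auto
    qed
    moreover have "\<not> (A (n - 1) \<and> Cl (n - 1))" using Cl[of "n - 1"] by (auto simp: A_def)
    moreover have "(\<forall>k<n. ?R ws k \<in> {A\<^sub>1, A\<^sub>2, A\<^sub>3, A\<^sub>4, A\<^sub>5} \<union> {B}) \<longleftrightarrow> (\<forall>k<n. A k \<or> Cl k)"
      using R by blast
    ultimately show ?thesis unfolding full last by argo
  qed
  have "{ws \<in> permutations_of_set {1..?N}. \<forall>k<n. ?R ws k \<in> {A\<^sub>1, A\<^sub>2, A\<^sub>3, A\<^sub>4, A\<^sub>5} \<union> {B}} =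
      down_ups {1..?N} \<union> ?L"
    using mem by (auto simp: down_ups_def)
  moreover have "down_ups {1..?N} \<inter> ?L = {}" using mem by (auto simp: down_ups_def)
  moreover have "finite ?L" by (rule finite_subset[OF _ finite_permutations_of_set[of "{1..?N}"]]) auto
  ultimately have "num_puzzles n ({A\<^sub>1, A\<^sub>2, A\<^sub>3, A\<^sub>4, A\<^sub>5} \<union> {B}) = card (down_ups {1..?N}) + card ?L"
    unfolding num_puzzles_eq_card_lists by (simp only: card_Un_disjoint finite_down_ups)
  moreover have "real (card (down_ups {1..?N})) = secant_number (n + 1)"
    unfolding secant_number_eq_card_down_ups by simp
  moreover have "card ?L = (\<Sum>i = 1..2 * n - 2. ((i + a) choose a) * ((2 * n + 1 - a - i) choose (3 - a)) * entringer (2 * n - 2) i)"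
  proof -
    \<comment> \<open>Reversing brings the entries \<open>y\<close>, \<open>x\<close>,
      \<open>b\<close> to the front and turns the prefix, of odd length \<open>2 * n - 1\<close>,
      into a down-up tail starting with \<open>v\<close>.\<close>
    let ?L' = "{ws \<in> permutations_of_set {1..?N}.
      down_up_list (drop 3 ws) \<and> C (ws ! 0) (ws ! 1) (ws ! 2) (ws ! 3)}"
    have rev_iff: "rev ws \<in> ?L' \<longleftrightarrow> ws \<in> ?L" if "length ws = ?N" for ws
    proof -
      have "drop 3 (rev ws) = rev (take (2 * n - 1) ws)"
        using that n by (simp add: drop_rev)
      moreover have "odd (length (take (2 * n - 1) ws))" using that n by simp
      ultimately have "down_up_list (drop 3 (rev ws)) \<longleftrightarrow> down_up_list (take (2 * n - 1) ws)"
        using down_up_list_rev by simp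
      moreover have "rev ws ! 0 = ws ! (2 * n + 1)" "rev ws ! 1 = ws ! (2 * n)"
          "rev ws ! 2 = ws ! (2 * n - 1)" "rev ws ! 3 = ws ! (2 * n - 2)"
        using that n by (simp_all add: rev_nth)
      ultimately show ?thesis by (simp add: permutations_of_set_def)
    qed
    have len: "length ws = ?N" if "ws \<in> permutations_of_set {1..?N}" for ws
      using length_finite_permutations_of_set[OF that] by simp
    have "bij_betw rev ?L ?L'"
    proof (rule bij_betw_byWitness[of _ rev])
      show "rev ` ?L \<subseteq> ?L'"
        by (rule image_subsetI, subst rev_iff) (simp_all add: len)
      show "rev ` ?L' \<subseteq> ?L"
      proof (rule image_subsetI)
        fix ws assume ws: "ws \<in> ?L'"
        then have "length (rev ws) = ?N" by (simp add: len)
        from rev_iff[OF this] show "rev ws \<in> ?L" using ws by (simp only: rev_rev_ident)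
      qed
    qed simp_all
    then have "card ?L = card ?L'" by (rule bij_betw_same_card)
    also have "\<dots> = (\<Sum>v\<in>{1..?N}. card {(y, x, b). {y, x, b} \<subseteq> {1..?N} \<and> C y x b v} * entringer (?N - 4) (v - 1 - a))"
    proof (rule card_down_ups_behind_three)
      fix y x b v assume "C y x b v"
      note * = C[OF this]
      then have "distinct [y, x, b]" by simp
      then show "distinct [y, x, b, v] \<and> card {u \<in> {y, x, b}. u < v} = a"
        unfolding card_less_in_three[OF \<open>distinct [y, x, b]\<close>] using * by blast
    qed (use n in simp)
    also have "\<dots> = (\<Sum>v\<in>{1..?N}. (((v - 1) choose a) * ((?N - v) choose (3 - a))) * entringer (?N - 4) (v - 1 - a))"
      using count by (intro sum.cong refl) simp
    also have "\<dots> = (\<Sum>i = 1..?N - 4. ((i + a) choose a) * ((?N - 1 - a - i) choose (3 - a)) * entringer (?N - 4) i)"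
      using a n by (intro sum_binomial_entringer_shift) auto
    also have "?N - 4 = 2 * n - 2" by simp
    also have "?N - 1 = 2 * n + 1" by simp
    finally show ?thesis .
  qed
  ultimately show ?thesis by simp
qed

section \<open>The counts, according to the rank of the upper left entry\<close>

text \<open>In these pieces the upper left entry is the largest, so \<open>a = 3\<close>; they
  differ only in how three smaller values are assigned to the other positions.\<close>

lemma num_puzzles_three_below:
  assumes n: "n \<ge> 2" and B: "B \<in> {B\<^sub>1, B\<^sub>5, B\<^sub>6}"
  shows "real (num_puzzles n ({A\<^sub>1, A\<^sub>2, A\<^sub>3, A\<^sub>4, A\<^sub>5} \<union> {B})) =
    real (\<Sum>i = 1..2 * n - 2. ((i + 3) choose 3) * entringer (2 * n - 2) i) + secant_number (n + 1)"
proof -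
  let ?T = "\<lambda>v. {(p::nat, q, r). p \<in> {1..<v} \<and> q \<in> {1..<v} \<and> r \<in> {1..<v} \<and> p < q \<and> q < r}"
  \<comment> \<open>The last factor is 1; it gives the count the shape that
    \<open>num_puzzles_insert\<close> expects.\<close>
  have T: "card (?T v) = ((v - 1) choose 3) * ((N - v) choose (3 - 3))" for v N :: nat
    using card_increasing_triples[of "{1..<v}"] by simp
  consider "B = B\<^sub>1" | "B = B\<^sub>5" | "B = B\<^sub>6" using B by auto
  then have "real (num_puzzles n ({A\<^sub>1, A\<^sub>2, A\<^sub>3, A\<^sub>4, A\<^sub>5} \<union> {B})) =
    real (\<Sum>i = 1..2 * n - 2. ((i + 3) choose 3) * ((2 * n + 1 - 3 - i) choose (3 - 3)) * entringer (2 * n - 2) i)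
      + secant_number (n + 1)"
  proof cases
    case 1
    \<comment> \<open>The increasing triple is distributed over \<open>y\<close>, \<open>x\<close>,
      \<open>b\<close> as the piece prescribes.\<close>
    have "bij_betw (\<lambda>(p, q, r). (r, q, p)) (?T v) {(y, x, b). {y, x, b} \<subseteq> {1..N} \<and> b < x \<and> x < y \<and> y < v}"
      if "v \<in> {1..N}" for v N
      by (rule bij_betw_byWitness[of _ "\<lambda>(r, q, p). (p, q, r)"]) (use that in auto)
    note count = trans[OF bij_betw_same_card[OF this, symmetric] T]
    show ?thesis
      unfolding 1
      by (rule num_puzzles_insert[OF n, of 3 _ "\<lambda>y x b v. b < x \<and> x < y \<and> y < v"])
        (simp, rule reduction_mat22_eq_Bs, simp, force, rule count)
  next
    case 2
    have "bij_betw (\<lambda>(p, q, r). (r, p, q)) (?T v) {(y, x, b). {y, x, b} \<subseteq> {1..N} \<and> x < b \<and> b < y \<and> y < v}"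
      if "v \<in> {1..N}" for v N
      by (rule bij_betw_byWitness[of _ "\<lambda>(r, p, q). (p, q, r)"]) (use that in auto)
    note count = trans[OF bij_betw_same_card[OF this, symmetric] T]
    show ?thesis
      unfolding 2
      by (rule num_puzzles_insert[OF n, of 3 _ "\<lambda>y x b v. x < b \<and> b < y \<and> y < v"])
        (simp, rule reduction_mat22_eq_Bs, simp, force, rule count)
  next
    case 3
    have "bij_betw (\<lambda>(p, q, r). (q, p, r)) (?T v) {(y, x, b). {y, x, b} \<subseteq> {1..N} \<and> x < y \<and> y < b \<and> b < v}"
      if "v \<in> {1..N}" for v N
      by (rule bij_betw_byWitness[of _ "\<lambda>(q, p, r). (p, q, r)"]) (use that in auto)
    note count = trans[OF bij_betw_same_card[OF this, symmetric] T]
    show ?thesis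
      unfolding 3
      by (rule num_puzzles_insert[OF n, of 3 _ "\<lambda>y x b v. x < y \<and> y < b \<and> b < v"])
        (simp, rule reduction_mat22_eq_Bs, simp, force, rule count)
  qed
  then show ?thesis by simp
qed

text \<open>Here the upper left entry has rank 3: \<open>x\<close> and \<open>b\<close> lie below it
  in a prescribed order and \<open>y\<close> above, so \<open>a = 2\<close>.\<close>

lemma num_puzzles_two_below:
  assumes n: "n \<ge> 2" and B: "B \<in> {B\<^sub>2, B\<^sub>4}"
  shows "real (num_puzzles n ({A\<^sub>1, A\<^sub>2, A\<^sub>3, A\<^sub>4, A\<^sub>5} \<union> {B})) =
    real (\<Sum>i = 1..2 * n - 2. (2 * n - 1 - i) * ((i + 2) choose 2) * entringer (2 * n - 2) i)
      + secant_number (n + 1)"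
proof -
  let ?T = "\<lambda>v N. {(p::nat, q). p \<in> {1..<v} \<and> q \<in> {1..<v} \<and> p < q} \<times> {v<..N}"
  have T: "card (?T v N) = ((v - 1) choose 2) * ((N - v) choose (3 - 2))" for v N :: nat
    using card_increasing_pairs[of "{1..<v}"] by (simp add: card_cartesian_product)
  consider "B = B\<^sub>2" | "B = B\<^sub>4" using B by auto
  then have "real (num_puzzles n ({A\<^sub>1, A\<^sub>2, A\<^sub>3, A\<^sub>4, A\<^sub>5} \<union> {B})) =
    real (\<Sum>i = 1..2 * n - 2. ((i + 2) choose 2) * ((2 * n + 1 - 2 - i) choose (3 - 2)) * entringer (2 * n - 2) i)
      + secant_number (n + 1)"
  proof cases
    case 1
    have "bij_betw (\<lambda>((p, q), r). (r, q, p)) (?T v N) {(y, x, b). {y, x, b} \<subseteq> {1..N} \<and> b < x \<and> x < v \<and> v < y}"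
      if "v \<in> {1..N}" for v N
      by (rule bij_betw_byWitness[of _ "\<lambda>(r, q, p). ((p, q), r)"]) (use that in auto)
    note count = trans[OF bij_betw_same_card[OF this, symmetric] T]
    show ?thesis
      unfolding 1
      by (rule num_puzzles_insert[OF n, of 2 _ "\<lambda>y x b v. b < x \<and> x < v \<and> v < y"])
        (simp, rule reduction_mat22_eq_Bs, simp, force, rule count)
  next
    case 2
    have "bij_betw (\<lambda>((p, q), r). (r, p, q)) (?T v N) {(y, x, b). {y, x, b} \<subseteq> {1..N} \<and> x < b \<and> b < v \<and> v < y}"
      if "v \<in> {1..N}" for v N
      by (rule bij_betw_byWitness[of _ "\<lambda>(r, p, q). ((p, q), r)"]) (use that in auto)
    note count = trans[OF bij_betw_same_card[OF this, symmetric] T]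
    show ?thesis
      unfolding 2
      by (rule num_puzzles_insert[OF n, of 2 _ "\<lambda>y x b v. x < b \<and> b < v \<and> v < y"])
        (simp, rule reduction_mat22_eq_Bs, simp, force, rule count)
  qed
  then show ?thesis by (simp add: mult_ac)
qed

text \<open>Here the upper left entry has rank 2: only \<open>b\<close> lies below it, so
  \<open>a = 1\<close>.\<close>

lemma num_puzzles_one_below:
  assumes n: "n \<ge> 2"
  shows "real (num_puzzles n ({A\<^sub>1, A\<^sub>2, A\<^sub>3, A\<^sub>4, A\<^sub>5} \<union> {B\<^sub>3})) =
    real (\<Sum>i = 1..2 * n - 2. (i + 1) * ((2 * n - i) choose 2) * entringer (2 * n - 2) i)
      + secant_number (n + 1)"
proof -
  let ?T = "\<lambda>v N. {1..<v} \<times> {(p::nat, q). p \<in> {v<..N} \<and> q \<in> {v<..N} \<and> p < q}"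
  have T: "card (?T v N) = ((v - 1) choose 1) * ((N - v) choose (3 - 1))" for v N :: nat
    using card_increasing_pairs[of "{v<..N}"] by (simp add: card_cartesian_product)
  have "bij_betw (\<lambda>(b, (p, q)). (q, p, b)) (?T v N) {(y, x, b). {y, x, b} \<subseteq> {1..N} \<and> b < v \<and> v < x \<and> x < y}"
    if "v \<in> {1..N}" for v N
    by (rule bij_betw_byWitness[of _ "\<lambda>(q, p, b). (b, (p, q))"]) (use that in auto)
  note count = trans[OF bij_betw_same_card[OF this, symmetric] T]
  have "real (num_puzzles n ({A\<^sub>1, A\<^sub>2, A\<^sub>3, A\<^sub>4, A\<^sub>5} \<union> {B\<^sub>3})) =
    real (\<Sum>i = 1..2 * n - 2. ((i + 1) choose 1) * ((2 * n + 1 - 1 - i) choose (3 - 1)) * entringer (2 * n - 2) i)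
      + secant_number (n + 1)"
    by (rule num_puzzles_insert[OF n, of 1 _ "\<lambda>y x b v. b < v \<and> v < x \<and> x < y"])
      (simp, rule reduction_mat22_eq_Bs, simp, force, rule count)
  then show ?thesis by simp
qed

theorem theorem4p8:
  fixes P :: "nat mat set" and n :: nat
  assumes "P = {A\<^sub>1, A\<^sub>2, A\<^sub>3, A\<^sub>4, A\<^sub>5}" and "n \<ge> 2"
  shows
    "(num_puzzles n (P \<union> {B\<^sub>1}) = num_puzzles n (P \<union> {B\<^sub>5}) \<and>
     num_puzzles n (P \<union> {B\<^sub>5}) = num_puzzles n (P \<union> {B\<^sub>6}) \<and>
     real (num_puzzles n (P \<union> {B\<^sub>6})) =
       real (\<Sum>i = 1..2 * n - 2. ((i + 3) choose 3) * entringer (2 * n - 2) i)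
         + secant_number (n + 1)) \<and>
     (num_puzzles n (P \<union> {B\<^sub>2}) = num_puzzles n (P \<union> {B\<^sub>4}) \<and>
     real (num_puzzles n (P \<union> {B\<^sub>4})) =
       real (\<Sum>i = 1..2 * n - 2. (2 * n - 1 - i) * ((i + 2) choose 2) * entringer (2 * n - 2) i)
         + secant_number (n + 1)) \<and>
     (real (num_puzzles n (P \<union> {B\<^sub>3})) =
       real (\<Sum>i = 1..2 * n - 2. (i + 1) * ((2 * n - i) choose 2) * entringer (2 * n - 2) i)
         + secant_number (n + 1))"
proof -
  note three = num_puzzles_three_below[OF assms(2)] and two = num_puzzles_two_below[OF assms(2)]
  \<comment> \<open>The formulas are equations between reals, as \<open>secant_number\<close> is
    real; injectivity of the embedding brings the equalities back to \<open>nat\<close>.\<close>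
  have "num_puzzles n (P \<union> {B\<^sub>1}) = num_puzzles n (P \<union> {B\<^sub>5})"
      "num_puzzles n (P \<union> {B\<^sub>5}) = num_puzzles n (P \<union> {B\<^sub>6})"
      "num_puzzles n (P \<union> {B\<^sub>2}) = num_puzzles n (P \<union> {B\<^sub>4})"
    unfolding assms(1)
    using three[of "B\<^sub>1"] three[of "B\<^sub>5"] three[of "B\<^sub>6"] two[of "B\<^sub>2"] two[of "B\<^sub>4"]
    by (simp_all only: insert_iff simp_thms of_nat_eq_iff[symmetric, where 'a = real])
  then show ?thesis
    using three[of "B\<^sub>6"] two[of "B\<^sub>4"] num_puzzles_one_below[OF assms(2)] assms(1) by blast
qed

end
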